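(* Let $n>0$ be an integer and let $C$ be an $n$-dimensional algebraic dyadic convex set. Then the following are equivalent: (i) $C$ is isomorphic (as a groupoid) to the dyadic simplex $\mathbf S_n$; (ii) $C$ is $(n+1)$-generated; (iii) $C$ is generated by its $n+1$ vertices (that is, $C$ has exactly $n+1$ vertices and they generate $C$).
   Context: $\mathbb D=\mathbb Z[1/2]$. Affine $\mathbb D$-spaces are regarded as algebras with the binary operations $ab\,\underline{r}=a(1-r)+br$, $r\in\mathbb D$; $\mathsf{Q_A}(\mathbb D)$ is the quasivariety of affine $\mathbb D$-spaces generated by the affine $\mathbb D$-space $\mathbb D$. Its finitely generated members are, up to isomorphism, the spaces $\mathbb D^n$, and $\mathbb D^n$ has dimension $n$. The groupoid operation is $x\circ y=\tfrac12(x+y)$. An algebraic dyadic convex set is a subset $C$, closed under $\circ$, of some affine $\mathbb D$-space $A\in\mathsf{Q_A}(\mathbb D)$; it is $n$-dimensional if its affine $\mathbb D$-hull $\mathrm{aff}_{\mathbb D}(C)$ (the smallest affine $\mathbb D$-subspace of $A$ containing $C$) has dimension $n$. $C$ is $k$-generated if it has a generating set (under $\circ$) with $k$ elements but none with fewer elements. A vertex of $C$ is a one-element wall: a point $v\in C$ such that for all $a,b\in C$, $a\circ b=v$ iff $a=b=v$. $\mathbf S_n=\{\sum_{i=0}^n e_ir_i : r_i\in\mathbb D\cap[0,1],\ \sum r_i=1\}\subseteq\mathbb D^n$, where $e_0=0$ and $e_1,\dots,e_n$ are the standard basis vectors. *)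

theory Defs
  imports Complex_Main
begin

definition dyadic_rats :: "rat set" ("\<bbbD>")
  where "\<bbbD> = {of_int m / 2 ^ k | (m :: int) (k :: nat). True}"

text \<open>
  An algebra of the type of affine \<open>\<bbbD>\<close>-spaces is a carrier together with a family
  \<open>f\<close> of binary operations, of which only the members \<open>f r\<close> with \<open>r \<in> \<bbbD>\<close> are meaningful.
\<close>

definition aff_closed :: "(rat \<Rightarrow> 'a \<Rightarrow> 'a \<Rightarrow> 'a) \<Rightarrow> 'a set \<Rightarrow> bool"
  where "aff_closed f B \<longleftrightarrow> (\<forall>r\<in>\<bbbD>. \<forall>a\<in>B. \<forall>b\<in>B. f r a b \<in> B)"

definition aff_iso ::
  "'a set \<Rightarrow> (rat \<Rightarrow> 'a \<Rightarrow> 'a \<Rightarrow> 'a) \<Rightarrow> 'b set \<Rightarrow> (rat \<Rightarrow> 'b \<Rightarrow> 'b \<Rightarrow> 'b) \<Rightarrow> bool"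
  where "aff_iso A f B g \<longleftrightarrow>
    (\<exists>\<phi>. bij_betw \<phi> A B \<and> (\<forall>r\<in>\<bbbD>. \<forall>a\<in>A. \<forall>b\<in>A. \<phi> (f r a b) = g r (\<phi> a) (\<phi> b)))"

definition scalar_op :: "rat \<Rightarrow> rat \<Rightarrow> rat \<Rightarrow> rat"
  where "scalar_op r a b = a * (1 - r) + b * r"

text \<open>
  The space \<open>\<bbbD>\<^sup>n\<close>: coordinates are indexed by \<open>1, \<dots>, n\<close>, and all other values are \<open>0\<close>,
  so that the representation is unique.
\<close>

definition dyadic_space :: "nat \<Rightarrow> (nat \<Rightarrow> rat) set"
  where "dyadic_space n = {x. (\<forall>i\<in>{1..n}. x i \<in> \<bbbD>) \<and> (\<forall>i. i \<notin> {1..n} \<longrightarrow> x i = 0)}"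

definition space_op :: "rat \<Rightarrow> (nat \<Rightarrow> rat) \<Rightarrow> (nat \<Rightarrow> rat) \<Rightarrow> (nat \<Rightarrow> rat)"
  where "space_op r x y = (\<lambda>i. scalar_op r (x i) (y i))"

datatype 'r aff_term = Var nat | Op 'r "'r aff_term" "'r aff_term"

primrec eval_term :: "('r \<Rightarrow> 'a \<Rightarrow> 'a \<Rightarrow> 'a) \<Rightarrow> (nat \<Rightarrow> 'a) \<Rightarrow> 'r aff_term \<Rightarrow> 'a"
  where
    "eval_term f v (Var i) = v i"
  | "eval_term f v (Op r s t) = f r (eval_term f v s) (eval_term f v t)"

definition dyadic_terms :: "rat aff_term set"
  where "dyadic_terms = {t. set_aff_term t \<subseteq> \<bbbD>}"

definition satisfies_quasi_identity ::
  "'a set \<Rightarrow> ('r \<Rightarrow> 'a \<Rightarrow> 'a \<Rightarrow> 'a)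
    \<Rightarrow> ('r aff_term \<times> 'r aff_term) list \<Rightarrow> 'r aff_term \<Rightarrow> 'r aff_term \<Rightarrow> bool"
  where "satisfies_quasi_identity A f ps s t \<longleftrightarrow>
    (\<forall>v. range v \<subseteq> A \<longrightarrow>
      (\<forall>(p, q) \<in> set ps. eval_term f v p = eval_term f v q) \<longrightarrow>
      eval_term f v s = eval_term f v t)"

text \<open>
  The quasivariety generated by the affine space \<open>\<bbbD>\<close> is the class of models of the
  quasi-identities that hold in \<open>\<bbbD>\<close>.  The case of no premises covers the identities of
  \<open>\<bbbD>\<close>, which axiomatise the variety of affine \<open>\<bbbD>\<close>-spaces, so every member is an affine
  \<open>\<bbbD>\<close>-space.
\<close>

definition in_QA :: "'a set \<Rightarrow> (rat \<Rightarrow> 'a \<Rightarrow> 'a \<Rightarrow> 'a) \<Rightarrow> bool"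
  where "in_QA A f \<longleftrightarrow> aff_closed f A \<and>
    (\<forall>ps s t. set ps \<subseteq> dyadic_terms \<times> dyadic_terms \<and> s \<in> dyadic_terms \<and> t \<in> dyadic_terms \<and>
      satisfies_quasi_identity \<bbbD> scalar_op ps s t \<longrightarrow> satisfies_quasi_identity A f ps s t)"

definition mid :: "(rat \<Rightarrow> 'a \<Rightarrow> 'a \<Rightarrow> 'a) \<Rightarrow> 'a \<Rightarrow> 'a \<Rightarrow> 'a"
  where "mid f = f (1 / 2)"

definition op_closed :: "('a \<Rightarrow> 'a \<Rightarrow> 'a) \<Rightarrow> 'a set \<Rightarrow> bool"
  where "op_closed m B \<longleftrightarrow> (\<forall>a\<in>B. \<forall>b\<in>B. m a b \<in> B)"

definition groupoid_iso ::
  "'a set \<Rightarrow> ('a \<Rightarrow> 'a \<Rightarrow> 'a) \<Rightarrow> 'b set \<Rightarrow> ('b \<Rightarrow> 'b \<Rightarrow> 'b) \<Rightarrow> bool"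
  where "groupoid_iso C m D k \<longleftrightarrow>
    (\<exists>\<phi>. bij_betw \<phi> C D \<and> (\<forall>a\<in>C. \<forall>b\<in>C. \<phi> (m a b) = k (\<phi> a) (\<phi> b)))"

definition algebraic_dyadic_convex_set ::
  "'a set \<Rightarrow> (rat \<Rightarrow> 'a \<Rightarrow> 'a \<Rightarrow> 'a) \<Rightarrow> 'a set \<Rightarrow> bool"
  where "algebraic_dyadic_convex_set A f C \<longleftrightarrow> in_QA A f \<and> C \<subseteq> A \<and> op_closed (mid f) C"

definition aff_hull :: "'a set \<Rightarrow> (rat \<Rightarrow> 'a \<Rightarrow> 'a \<Rightarrow> 'a) \<Rightarrow> 'a set \<Rightarrow> 'a set"
  where "aff_hull A f C = (\<lambda>B. B \<subseteq> A \<and> aff_closed f B) hull C"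

definition has_dimension ::
  "'a set \<Rightarrow> (rat \<Rightarrow> 'a \<Rightarrow> 'a \<Rightarrow> 'a) \<Rightarrow> 'a set \<Rightarrow> nat \<Rightarrow> bool"
  where "has_dimension A f C n \<longleftrightarrow> aff_iso (aff_hull A f C) f (dyadic_space n) space_op"

definition generates :: "('a \<Rightarrow> 'a \<Rightarrow> 'a) \<Rightarrow> 'a set \<Rightarrow> 'a set \<Rightarrow> bool"
  where "generates m G C \<longleftrightarrow> G \<subseteq> C \<and> op_closed m hull G = C"

definition k_generated :: "('a \<Rightarrow> 'a \<Rightarrow> 'a) \<Rightarrow> 'a set \<Rightarrow> nat \<Rightarrow> bool"
  where "k_generated m C k \<longleftrightarrow>
    (\<exists>G. finite G \<and> card G = k \<and> generates m G C) \<and>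
    (\<forall>G. finite G \<and> generates m G C \<longrightarrow> k \<le> card G)"

definition vertices :: "('a \<Rightarrow> 'a \<Rightarrow> 'a) \<Rightarrow> 'a set \<Rightarrow> 'a set"
  where "vertices m C = {v \<in> C. \<forall>a\<in>C. \<forall>b\<in>C. m a b = v \<longleftrightarrow> a = v \<and> b = v}"

definition simplex_vertex :: "nat \<Rightarrow> nat \<Rightarrow> rat"
  where "simplex_vertex i = (\<lambda>j. if i \<noteq> 0 \<and> j = i then 1 else 0)"

definition dyadic_simplex :: "nat \<Rightarrow> (nat \<Rightarrow> rat) set"
  where "dyadic_simplex n =
    {(\<lambda>j. \<Sum>i = 0..n. simplex_vertex i j * r i) | r.
      (\<forall>i\<in>{0..n}. r i \<in> \<bbbD> \<inter> {0..1}) \<and> (\<Sum>i = 0..n. r i) = 1}"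

end

theory Submission
  imports Defs "HOL-Library.Function_Algebras"
begin

text \<open>
  A vertex is not the midpoint of other points, so removing it from a convex set leaves a
  groupoid; hence vertices belong to every generating set
  (\<open>vertices_subset_generating_set\<close>).  A set generated by \<open>n + 1\<close> vertices is
  therefore \<open>(n + 1)\<close>-generated.  The simplex \<open>\<^bold>S\<^sub>n\<close> is generated by the points
  \<open>e\<^sub>0, \<dots>, e\<^sub>n\<close>, and these are its vertices because barycentric coordinates are
  nonnegative; this description is transported along groupoid isomorphisms.

  The remaining implication, from \<open>n + 1\<close> generators \<open>g\<^sub>0, \<dots>, g\<^sub>n\<close> to the simplex,
  is where the dimension enters.  Inside \<open>\<bbbD>\<^sup>n\<close> the generated set consists of all
  combinations \<open>\<Sum> r\<^sub>i g\<^sub>i\<close> with nonnegative dyadic weights of sum \<open>1\<close>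
  (\<open>midpoint_hull_eq_convex_combinations\<close>).  So sending a point of \<open>\<^bold>S\<^sub>n\<close> with
  weights \<open>r\<close> to \<open>\<Sum> r\<^sub>i g\<^sub>i\<close> is a surjective homomorphism, and it is injective
  once the \<open>g\<^sub>i\<close> are affinely independent.  They are: the \<open>g\<^sub>i\<close> affinely generate all
  of \<open>\<bbbD>\<^sup>n\<close>, and \<open>n + 1\<close> points with this property are independent already over the
  rationals, by the usual count of dimensions (\<open>affine_spanning_independent\<close>).
\<close>

section \<open>Dyadic rationals\<close>

lemma dyadic_ratsI: "of_int m / 2 ^ k \<in> \<bbbD>"
  unfolding dyadic_rats_def by blast

lemma dyadic_rats_0 [simp]: "0 \<in> \<bbbD>"
  using dyadic_ratsI [of 0 0] by simp

lemma dyadic_rats_1 [simp]: "1 \<in> \<bbbD>"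
  using dyadic_ratsI [of 1 0] by simp

lemma dyadic_rats_half [simp]: "1 / 2 \<in> \<bbbD>"
  using dyadic_ratsI [of 1 1] by simp

lemma dyadic_rats_add: "x \<in> \<bbbD> \<Longrightarrow> y \<in> \<bbbD> \<Longrightarrow> x + y \<in> \<bbbD>"
proof -
  assume "x \<in> \<bbbD>" "y \<in> \<bbbD>"
  then obtain m k p l where "x = of_int m / 2 ^ k" "y = of_int p / 2 ^ l"
    unfolding dyadic_rats_def by blast
  then have "x + y = of_int (m * 2 ^ l + p * 2 ^ k) / 2 ^ (k + l)"
    by (simp add: add_divide_distrib power_add)
  then show "x + y \<in> \<bbbD>"
    using dyadic_ratsI by metis
qed

lemma dyadic_rats_mult: "x \<in> \<bbbD> \<Longrightarrow> y \<in> \<bbbD> \<Longrightarrow> x * y \<in> \<bbbD>"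
proof -
  assume "x \<in> \<bbbD>" "y \<in> \<bbbD>"
  then obtain m k p l where "x = of_int m / 2 ^ k" "y = of_int p / 2 ^ l"
    unfolding dyadic_rats_def by blast
  then have "x * y = of_int (m * p) / 2 ^ (k + l)"
    by (simp add: power_add)
  then show "x * y \<in> \<bbbD>"
    using dyadic_ratsI by metis
qed

lemma dyadic_rats_diff: "x \<in> \<bbbD> \<Longrightarrow> y \<in> \<bbbD> \<Longrightarrow> x - y \<in> \<bbbD>"
  using dyadic_rats_add [of x "- 1 * y"] dyadic_rats_mult [of "- 1" y] dyadic_ratsI [of "- 1" 0]
  by simp

lemma dyadic_rats_sum: "(\<And>i. i \<in> I \<Longrightarrow> x i \<in> \<bbbD>) \<Longrightarrow> sum x I \<in> \<bbbD>"
  by (induction I rule: infinite_finite_induct) (auto intro: dyadic_rats_add)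

lemma scalar_op_dyadic: "r \<in> \<bbbD> \<Longrightarrow> x \<in> \<bbbD> \<Longrightarrow> y \<in> \<bbbD> \<Longrightarrow> scalar_op r x y \<in> \<bbbD>"
  unfolding scalar_op_def
  by (intro dyadic_rats_add dyadic_rats_mult dyadic_rats_diff) auto

lemma dyadic_common_denominator:
  assumes "finite I" "\<And>i. i \<in> I \<Longrightarrow> x i \<in> \<bbbD>" "\<And>i. i \<in> I \<Longrightarrow> 0 \<le> x i"
  shows "\<exists>(m :: _ \<Rightarrow> nat) k. \<forall>i\<in>I. x i = of_nat (m i) / 2 ^ k"
  using assms
proof (induction I rule: finite_induct)
  case empty
  then show ?case by simp
next
  case (insert j I)
  then obtain m :: "_ \<Rightarrow> nat" and k where m: "\<forall>i\<in>I. x i = of_nat (m i) / 2 ^ k"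
    by auto
  have "x j \<in> \<bbbD>"
    using insert.prems by auto
  then obtain p l where p: "x j = of_int p / 2 ^ l"
    unfolding dyadic_rats_def by blast
  have "0 \<le> x j"
    using insert.prems by auto
  moreover have "of_int p = x j * 2 ^ l"
    by (simp add: p)
  ultimately have "0 \<le> (of_int p :: rat)"
    by simp
  then have "0 \<le> p"
    by simp
  then have j: "x j = of_nat (nat p) / 2 ^ l"
    by (simp add: p)
  \<comment> \<open>Both fractions are brought to the denominator \<open>2 ^ (k + l)\<close>.\<close>
  let ?m = "\<lambda>i. if i = j then nat p * 2 ^ k else m i * 2 ^ l"
  have "\<forall>i\<in>insert j I. x i = of_nat (?m i) / 2 ^ (k + l)"
    using m j insert.hyps by (auto simp: power_add)
  then show ?case
    by (intro exI [of _ ?m] exI [of _ "k + l"])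
qed

section \<open>Generating sets and vertices of groupoids\<close>

lemma op_closed_hull: "op_closed m (op_closed m hull G)"
  by (rule hull_in) (auto simp: op_closed_def)

lemma op_closedD: "op_closed m B \<Longrightarrow> a \<in> B \<Longrightarrow> b \<in> B \<Longrightarrow> m a b \<in> B"
  by (simp add: op_closed_def)

text \<open>
  One inclusion holds because the image of \<open>C\<close> is closed, the other because the preimage of
  the groupoid generated by \<open>\<phi> ` G\<close> is closed.
\<close>

lemma generates_hom_image:
  assumes hom: "\<forall>a\<in>C. \<forall>b\<in>C. \<phi> (m a b) = k (\<phi> a) (\<phi> b)"
    and closed: "op_closed m C" and gen: "generates m G C"
  shows "generates k (\<phi> ` G) (\<phi> ` C)"
  unfolding generates_def
proof (intro conjI equalityI)
  have GC: "G \<subseteq> C" and C: "op_closed m hull G = C"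
    using gen by (auto simp: generates_def)
  show "\<phi> ` G \<subseteq> \<phi> ` C"
    using GC by blast
  have "op_closed k (\<phi> ` C)"
    unfolding op_closed_def
  proof (intro ballI)
    fix x y assume "x \<in> \<phi> ` C" "y \<in> \<phi> ` C"
    then obtain a b where "a \<in> C" "b \<in> C" "x = \<phi> a" "y = \<phi> b"
      by blast
    then show "k x y \<in> \<phi> ` C"
      using hom op_closedD [OF closed, of a b] by (metis image_eqI)
  qed
  then show "op_closed k hull (\<phi> ` G) \<subseteq> \<phi> ` C"
    using GC by (intro hull_minimal) auto
  have "op_closed m {c \<in> C. \<phi> c \<in> op_closed k hull (\<phi> ` G)}"
    using hom closed op_closed_hull [of k "\<phi> ` G"] by (auto simp: op_closed_def)
  moreover have "G \<subseteq> {c \<in> C. \<phi> c \<in> op_closed k hull (\<phi> ` G)}"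
    using GC hull_subset [of "\<phi> ` G" "op_closed k"] by auto
  ultimately have "op_closed m hull G \<subseteq> {c \<in> C. \<phi> c \<in> op_closed k hull (\<phi> ` G)}"
    by (rule hull_minimal [rotated])
  then show "\<phi> ` C \<subseteq> op_closed k hull (\<phi> ` G)"
    using C by auto
qed

lemma vertices_iso_image:
  assumes hom: "\<forall>a\<in>C. \<forall>b\<in>C. \<phi> (m a b) = k (\<phi> a) (\<phi> b)"
    and closed: "op_closed m C" and inj: "inj_on \<phi> C"
  shows "vertices k (\<phi> ` C) = \<phi> ` vertices m C"
proof -
  have "k (\<phi> a) (\<phi> b) = \<phi> v \<longleftrightarrow> m a b = v" "\<phi> a = \<phi> v \<longleftrightarrow> a = v"
    if "a \<in> C" "b \<in> C" "v \<in> C" for a b v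
  proof -
    have "k (\<phi> a) (\<phi> b) = \<phi> (m a b)"
      using hom that by simp
    then show "k (\<phi> a) (\<phi> b) = \<phi> v \<longleftrightarrow> m a b = v" "\<phi> a = \<phi> v \<longleftrightarrow> a = v"
      using inj_on_eq_iff [OF inj op_closedD [OF closed that(1,2)] that(3)]
        inj_on_eq_iff [OF inj that(1,3)] by simp_all
  qed
  then have "\<phi> v \<in> vertices k (\<phi> ` C) \<longleftrightarrow> v \<in> vertices m C" if "v \<in> C" for v
    using that by (simp add: vertices_def)
  moreover have "vertices m C \<subseteq> C" "vertices k (\<phi> ` C) \<subseteq> \<phi> ` C"
    by (auto simp: vertices_def)
  ultimately show ?thesis
    by blast
qed

text \<open>The complement of a vertex is closed, so a generating set cannot avoid the vertex.\<close>

lemma vertices_subset_generating_set: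
  assumes "op_closed m C" "generates m G C"
  shows "vertices m C \<subseteq> G"
proof
  fix v assume v: "v \<in> vertices m C"
  show "v \<in> G"
  proof (rule ccontr)
    assume "v \<notin> G"
    moreover have "op_closed m (C - {v})"
      using assms(1) v by (auto simp: op_closed_def vertices_def)
    ultimately have "op_closed m hull G \<subseteq> C - {v}"
      using assms(2) by (intro hull_minimal) (auto simp: generates_def)
    then show False
      using assms(2) v by (auto simp: generates_def vertices_def)
  qed
qed

lemma k_generated_by_vertices:
  assumes closed: "op_closed m C" and gen: "generates m (vertices m C) C"
    and fin: "finite (vertices m C)"
  shows "k_generated m C (card (vertices m C))"
  unfolding k_generated_def
  using fin gen by (auto intro!: card_mono dest: vertices_subset_generating_set [OF closed])

lemma groupoid_iso_sym:
  assumes iso: "groupoid_iso C m D k" and closed: "op_closed m C"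
  shows "groupoid_iso D k C m"
proof -
  obtain \<phi> where bij: "bij_betw \<phi> C D"
    and hom: "\<forall>a\<in>C. \<forall>b\<in>C. \<phi> (m a b) = k (\<phi> a) (\<phi> b)"
    using iso by (auto simp: groupoid_iso_def)
  have "inv_into C \<phi> (k (\<phi> a) (\<phi> b)) = m a b" if "a \<in> C" "b \<in> C" for a b
    using that hom op_closedD [OF closed that] inv_into_f_f [OF bij_betw_imp_inj_on [OF bij]]
    by metis
  then have "\<forall>a\<in>D. \<forall>b\<in>D. inv_into C \<phi> (k a b) = m (inv_into C \<phi> a) (inv_into C \<phi> b)"
    using bij_betw_imp_surj_on [OF bij] inv_into_f_f [OF bij_betw_imp_inj_on [OF bij]] by force
  then show ?thesis
    using bij_betw_inv_into [OF bij] by (auto simp: groupoid_iso_def)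
qed

lemma groupoid_iso_trans:
  assumes "groupoid_iso C m D k" "groupoid_iso D k E l"
  shows "groupoid_iso C m E l"
proof -
  obtain \<phi> \<psi> where "bij_betw \<phi> C D" "bij_betw \<psi> D E"
    and "\<forall>a\<in>C. \<forall>b\<in>C. \<phi> (m a b) = k (\<phi> a) (\<phi> b)"
    and "\<forall>a\<in>D. \<forall>b\<in>D. \<psi> (k a b) = l (\<psi> a) (\<psi> b)"
    using assms by (auto simp: groupoid_iso_def)
  then show ?thesis
    unfolding groupoid_iso_def
    by (intro exI [of _ "\<psi> \<circ> \<phi>"]) (auto intro: bij_betw_trans simp: bij_betw_apply)
qed

section \<open>Affine and convex combinations\<close>

definition affine_weights :: "nat \<Rightarrow> (nat \<Rightarrow> rat) set"
  where "affine_weights n = {r. (\<forall>i\<in>{0..n}. r i \<in> \<bbbD>) \<and> (\<Sum>i=0..n. r i) = 1}"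

definition convex_weights :: "nat \<Rightarrow> (nat \<Rightarrow> rat) set"
  where "convex_weights n = {r \<in> affine_weights n. \<forall>i\<in>{0..n}. 0 \<le> r i}"

definition combination :: "nat \<Rightarrow> (nat \<Rightarrow> nat \<Rightarrow> rat) \<Rightarrow> (nat \<Rightarrow> rat) \<Rightarrow> nat \<Rightarrow> rat"
  where "combination n g r = (\<lambda>j. \<Sum>i=0..n. r i * g i j)"

lemma combination_cong:
  "(\<And>i. i \<in> {0..n} \<Longrightarrow> r i = s i) \<Longrightarrow> combination n g r = combination n g s"
  by (auto simp: combination_def intro!: sum.cong)

lemma space_op_combination:
  "space_op t (combination n g r) (combination n g s) = combination n g (space_op t r s)"
proof
  fix j
  have "combination n g (space_op t r s) j
      = (\<Sum>i=0..n. r i * g i j * (1 - t) + s i * g i j * t)"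
    unfolding combination_def space_op_def scalar_op_def
    by (intro sum.cong) (auto simp: algebra_simps)
  then show "space_op t (combination n g r) (combination n g s) j = combination n g (space_op t r s) j"
    by (simp add: combination_def space_op_def scalar_op_def sum.distrib sum_distrib_right)
qed

lemma sum_space_op:
  "(\<Sum>i\<in>I. space_op t r s i) = scalar_op t (\<Sum>i\<in>I. r i) (\<Sum>i\<in>I. s i)"
  by (simp add: space_op_def scalar_op_def sum_distrib_right sum.distrib)

lemma space_op_affine_weights:
  assumes "t \<in> \<bbbD>" "r \<in> affine_weights n" "s \<in> affine_weights n"
  shows "space_op t r s \<in> affine_weights n"
proof -
  have "space_op t r s i \<in> \<bbbD>" if "i \<in> {0..n}" for i
    using assms that by (simp add: affine_weights_def space_op_def scalar_op_dyadic)
  moreover have "(\<Sum>i=0..n. space_op t r s i) = 1"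
    using assms by (simp add: affine_weights_def sum_space_op scalar_op_def)
  ultimately show ?thesis
    by (simp add: affine_weights_def)
qed

lemma mid_convex_weights:
  assumes "r \<in> convex_weights n" "s \<in> convex_weights n"
  shows "mid space_op r s \<in> convex_weights n"
  using assms space_op_affine_weights [of "1 / 2" r n s]
  by (auto simp: convex_weights_def mid_def space_op_def scalar_op_def)

lemma unit_convex_weights: "i \<le> n \<Longrightarrow> (\<lambda>j. if j = i then 1 else 0) \<in> convex_weights n"
  by (auto simp: convex_weights_def affine_weights_def)

lemma combination_unit: "i \<le> n \<Longrightarrow> combination n g (\<lambda>j. if j = i then 1 else 0) = g i"
  by (auto simp: combination_def if_distrib [of "\<lambda>x. x * _"] cong: if_cong)

text \<open>
  Weights with common denominator \<open>2\<^sup>k\<close> are natural numbers of sum \<open>2\<^sup>k\<close>.  Such a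
  system of weights can be divided into two parts of equal sum, which exhibits the combination
  as a midpoint of two combinations of smaller denominator.
\<close>

lemma nat_weights_split:
  fixes m :: "'b \<Rightarrow> nat"
  assumes "finite I" "s \<le> sum m I"
  shows "\<exists>p. (\<forall>i\<in>I. p i \<le> m i) \<and> sum p I = s"
  using assms
proof (induction I arbitrary: s rule: finite_induct)
  case empty
  then show ?case by simp
next
  case (insert j I)
  have "s \<le> m j + sum m I"
    using insert.prems insert.hyps by simp
  then have "s - min s (m j) \<le> sum m I"
    by linarith
  then obtain p where p: "\<forall>i\<in>I. p i \<le> m i" "sum p I = s - min s (m j)"
    using insert.IH by blast
  have "sum (p(j := min s (m j))) I = sum p I"
    using insert.hyps by (intro sum.cong) auto
  then show ?case
    using p insert.hyps by (intro exI [of _ "p(j := min s (m j))"]) auto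
qed

lemma combination_nat_weights_in_hull:
  fixes m :: "nat \<Rightarrow> nat"
  assumes "(\<Sum>i=0..n. m i) = 2 ^ k"
  shows "combination n g (\<lambda>i. of_nat (m i) / 2 ^ k) \<in> op_closed (mid space_op) hull (g ` {0..n})"
  using assms
proof (induction k arbitrary: m)
  case 0
  then obtain i where i: "i \<in> {0..n}" "m i = 1" "\<forall>j\<in>{0..n}. j \<noteq> i \<longrightarrow> m j = 0"
    using sum_eq_1_iff [of "{0..n}" m] by auto
  then have "combination n g (\<lambda>i. of_nat (m i) / 2 ^ 0)
      = combination n g (\<lambda>j. if j = i then 1 else 0)"
    by (intro combination_cong) auto
  then have "combination n g (\<lambda>i. of_nat (m i) / 2 ^ 0) = g i"
    using i combination_unit by simp
  then show ?case
    using i by (simp add: hull_inc)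
next
  case (Suc k)
  obtain p where p: "\<forall>i\<in>{0..n}. p i \<le> m i" "sum p {0..n} = 2 ^ k"
    using nat_weights_split [of "{0..n}" "2 ^ k" m] Suc.prems by auto
  define q where "q i = m i - p i" for i
  have "sum q {0..n} = 2 ^ k"
    using p Suc.prems sum_subtractf_nat [of "{0..n}" p m] by (simp add: q_def)
  then have "mid space_op (combination n g (\<lambda>i. of_nat (p i) / 2 ^ k))
      (combination n g (\<lambda>i. of_nat (q i) / 2 ^ k)) \<in> op_closed (mid space_op) hull (g ` {0..n})"
    using Suc.IH [of p] Suc.IH [of q] p(2) by (intro op_closedD [OF op_closed_hull]) auto
  moreover have "mid space_op (combination n g (\<lambda>i. of_nat (p i) / 2 ^ k))
      (combination n g (\<lambda>i. of_nat (q i) / 2 ^ k)) = combination n g (\<lambda>i. of_nat (m i) / 2 ^ Suc k)"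
    unfolding mid_def space_op_combination
    using p(1)
    by (intro combination_cong) (auto simp: space_op_def scalar_op_def q_def of_nat_diff field_simps)
  ultimately show ?case
    by simp
qed

text \<open>
  Convex combinations with dyadic weights are closed under midpoints, and splitting the
  weights into equal parts again and again leads from any of them down to the points themselves.
\<close>

lemma midpoint_hull_eq_convex_combinations:
  "op_closed (mid space_op) hull (g ` {0..n}) = combination n g ` convex_weights n"
proof (rule equalityI)
  show "op_closed (mid space_op) hull (g ` {0..n}) \<subseteq> combination n g ` convex_weights n"
  proof (rule hull_minimal)
    show "g ` {0..n} \<subseteq> combination n g ` convex_weights n"
    proof
      fix x assume "x \<in> g ` {0..n}"
      then obtain i where "i \<le> n" "x = g i" by auto
      then show "x \<in> combination n g ` convex_weights n"
        using combination_unit [of i n g] unit_convex_weights [of i n] by (metis image_eqI)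
    qed
    show "op_closed (mid space_op) (combination n g ` convex_weights n)"
      unfolding op_closed_def
      using mid_convex_weights by (auto simp: mid_def space_op_combination)
  qed
  show "combination n g ` convex_weights n \<subseteq> op_closed (mid space_op) hull (g ` {0..n})"
  proof
    fix x assume "x \<in> combination n g ` convex_weights n"
    then obtain r where r: "r \<in> convex_weights n" "x = combination n g r"
      by auto
    then obtain m :: "nat \<Rightarrow> nat" and k where m: "\<forall>i\<in>{0..n}. r i = of_nat (m i) / 2 ^ k"
      using dyadic_common_denominator [of "{0..n}" r]
      by (auto simp: convex_weights_def affine_weights_def)
    have "(\<Sum>i=0..n. r i) = of_nat (\<Sum>i=0..n. m i) / 2 ^ k"
      using m by (simp add: sum_divide_distrib)
    then have "(of_nat (\<Sum>i=0..n. m i) :: rat) = of_nat (2 ^ k)"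
      using r by (simp add: convex_weights_def affine_weights_def del: of_nat_sum)
    then have "(\<Sum>i=0..n. m i) = 2 ^ k"
      using of_nat_eq_iff by blast
    moreover have "x = combination n g (\<lambda>i. of_nat (m i) / 2 ^ k)"
      unfolding r(2) using m by (intro combination_cong) auto
    ultimately show "x \<in> op_closed (mid space_op) hull (g ` {0..n})"
      using combination_nat_weights_in_hull by simp
  qed
qed

lemma affine_combinations_closed: "aff_closed space_op (combination n g ` affine_weights n)"
  unfolding aff_closed_def using space_op_affine_weights by (auto simp: space_op_combination)

lemma combination_in_dyadic_space:
  assumes "r \<in> affine_weights n" "\<And>i. i \<in> {0..n} \<Longrightarrow> g i \<in> dyadic_space d"
  shows "combination n g r \<in> dyadic_space d"
  using assms
  by (auto simp: combination_def dyadic_space_def affine_weights_def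
      intro!: dyadic_rats_sum dyadic_rats_mult sum.neutral)

section \<open>The dyadic simplex\<close>

text \<open>
  The weights with which \<open>x\<close> is an affine combination of \<open>e\<^sub>0, \<dots>, e\<^sub>n\<close>.  As
  \<open>e\<^sub>0 = 0\<close>, the weights with positive index are the coordinates of \<open>x\<close>, and index
  \<open>0\<close> carries what is missing to a total of \<open>1\<close>.
\<close>

definition barycentric :: "nat \<Rightarrow> (nat \<Rightarrow> rat) \<Rightarrow> nat \<Rightarrow> rat"
  where "barycentric n x = (\<lambda>i. if i = 0 then 1 - (\<Sum>j=1..n. x j) else x i)"

lemma combination_simplex_vertex:
  "combination n simplex_vertex r j = (if j \<in> {1..n} then r j else 0)"
proof (cases "j \<in> {1..n}")
  case True
  then have "combination n simplex_vertex r j = (\<Sum>i=0..n. if i = j then r i else 0)"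
    unfolding combination_def simplex_vertex_def by (intro sum.cong) auto
  then show ?thesis
    using True by simp
next
  case False
  then show ?thesis
    by (auto simp: combination_def simplex_vertex_def intro!: sum.neutral)
qed

lemma simplex_vertex_in_dyadic_space: "i \<le> n \<Longrightarrow> simplex_vertex i \<in> dyadic_space n"
  by (auto simp: simplex_vertex_def dyadic_space_def)

lemma dyadic_simplex_eq: "dyadic_simplex n = combination n simplex_vertex ` convex_weights n"
proof -
  have "r i \<le> 1" if "r \<in> convex_weights n" "i \<in> {0..n}" for r i
    using that member_le_sum [of i "{0..n}" r] by (auto simp: convex_weights_def affine_weights_def)
  then have "convex_weights n
      = {r. (\<forall>i\<in>{0..n}. r i \<in> \<bbbD> \<inter> {0..1}) \<and> (\<Sum>i=0..n. r i) = 1}"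
    by (auto simp: convex_weights_def affine_weights_def)
  then show ?thesis
    unfolding dyadic_simplex_def combination_def by (auto simp: mult.commute)
qed

lemma barycentric_combination:
  assumes "(\<Sum>i=0..n. r i) = 1" "i \<in> {0..n}"
  shows "barycentric n (combination n simplex_vertex r) i = r i"
proof -
  have "r 0 = 1 - (\<Sum>j=1..n. r j)"
    using assms(1) by (simp add: sum.atLeast_Suc_atMost)
  then show ?thesis
    using assms(2) by (simp add: barycentric_def combination_simplex_vertex)
qed

lemma barycentric_space_op:
  "barycentric n (space_op t x y) = space_op t (barycentric n x) (barycentric n y)"
proof
  fix i
  show "barycentric n (space_op t x y) i = space_op t (barycentric n x) (barycentric n y) i"
    using sum_space_op [of t x y "{1..n}"]
    by (cases "i = 0") (simp_all add: barycentric_def space_op_def scalar_op_def algebra_simps)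
qed

lemma dyadic_simplex_generated: "generates (mid space_op) (simplex_vertex ` {0..n}) (dyadic_simplex n)"
  unfolding generates_def dyadic_simplex_eq midpoint_hull_eq_convex_combinations [symmetric]
  by (simp add: hull_subset)

lemma dyadic_simplex_closed: "op_closed (mid space_op) (dyadic_simplex n)"
  using op_closed_hull dyadic_simplex_generated unfolding generates_def by metis

text \<open>
  There are no further vertices since the \<open>e\<^sub>i\<close> generate.  Conversely, if \<open>e\<^sub>i\<close> is a
  midpoint, then the nonnegative weights of the two endpoints have mean \<open>0\<close> at every
  \<open>j \<noteq> i\<close>, so they vanish there, and only \<open>e\<^sub>i\<close> itself has such weights.
\<close>

lemma vertices_dyadic_simplex: "vertices (mid space_op) (dyadic_simplex n) = simplex_vertex ` {0..n}"
proof (rule equalityI)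
  show "vertices (mid space_op) (dyadic_simplex n) \<subseteq> simplex_vertex ` {0..n}"
    by (rule vertices_subset_generating_set [OF dyadic_simplex_closed dyadic_simplex_generated])
  show "simplex_vertex ` {0..n} \<subseteq> vertices (mid space_op) (dyadic_simplex n)"
  proof
    fix v assume "v \<in> simplex_vertex ` {0..n}"
    then obtain i where i: "i \<le> n" and v: "v = simplex_vertex i" by auto
    let ?u = "\<lambda>j. if j = i then 1 else (0 :: rat)"
    have key: "r j = ?u j" if
      r: "r \<in> convex_weights n" and s: "s \<in> convex_weights n" and j: "j \<in> {0..n}" and
      rs: "mid space_op (combination n simplex_vertex r) (combination n simplex_vertex s) = v"
      for r s j
    proof -
      have "combination n simplex_vertex (mid space_op r s) = combination n simplex_vertex ?u"
        using rs i by (simp add: v combination_unit mid_def space_op_combination)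
      then have "mid space_op r s j = ?u j" if "j \<in> {0..n}" for j
        using barycentric_combination [OF _ that, of "mid space_op r s"]
          barycentric_combination [OF _ that, of ?u]
          mid_convex_weights [OF r s] unit_convex_weights [OF i]
        by (simp add: convex_weights_def affine_weights_def)
      then have mean: "r j * (1 - 1 / 2) + s j * (1 / 2) = ?u j" if "j \<in> {0..n}" for j
        using that unfolding mid_def space_op_def scalar_op_def by blast
      have zero: "r j = 0" if "j \<in> {0..n}" "j \<noteq> i" for j
      proof -
        have "r j + s j = 0"
          using mean [OF that(1)] that(2) by simp
        moreover have "0 \<le> r j" "0 \<le> s j"
          using r s that by (auto simp: convex_weights_def)
        ultimately show ?thesis
          by linarith
      qed
      have "(\<Sum>j=0..n. r j) = r i + (\<Sum>j\<in>{0..n} - {i}. r j)"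
        using i by (intro sum.remove) auto
      also have "(\<Sum>j\<in>{0..n} - {i}. r j) = 0"
        using zero by (intro sum.neutral) auto
      finally show ?thesis
        using r zero j by (auto simp: convex_weights_def affine_weights_def)
    qed
    have left: "a = v" if ab: "a \<in> dyadic_simplex n" "b \<in> dyadic_simplex n" "mid space_op a b = v" for a b
    proof -
      obtain r s where rs: "r \<in> convex_weights n" "s \<in> convex_weights n"
        and a: "a = combination n simplex_vertex r" and b: "b = combination n simplex_vertex s"
        using ab by (auto simp: dyadic_simplex_eq)
      have "combination n simplex_vertex r = combination n simplex_vertex ?u"
        using key [OF rs] ab(3) a b by (intro combination_cong) auto
      then show ?thesis
        using a v i combination_unit by simp
    qed
    have comm: "mid space_op a b = mid space_op b a" for a b
      by (simp add: mid_def space_op_def scalar_op_def algebra_simps)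
    have "v \<in> dyadic_simplex n"
      using dyadic_simplex_generated [of n] v i by (auto simp: generates_def)
    moreover have "mid space_op v v = v"
      by (simp add: mid_def space_op_def scalar_op_def)
    ultimately show "v \<in> vertices (mid space_op) (dyadic_simplex n)"
      unfolding vertices_def using left left [of _ _, OF _ _ trans [OF comm]] by blast
  qed
qed

lemma card_vertices_dyadic_simplex: "card (vertices (mid space_op) (dyadic_simplex n)) = n + 1"
proof -
  have "inj_on simplex_vertex {0..n}"
  proof (rule inj_onI)
    fix i k assume "simplex_vertex i = simplex_vertex k"
    then have "simplex_vertex i i = simplex_vertex k i" "simplex_vertex i k = simplex_vertex k k"
      by simp_all
    then show "i = k"
      by (auto simp: simplex_vertex_def split: if_splits)
  qed
  then show ?thesis
    by (simp add: vertices_dyadic_simplex card_image)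
qed

section \<open>Affine independence of affine generating systems\<close>

text \<open>
  In a nontrivial relation one vector of the family lies in the span of the others; then fewer
  than \<open>card S\<close> vectors would span the independent set \<open>S\<close>.
\<close>

lemma (in vector_space) spanning_family_independent:
  assumes fin: "finite I" and indep: "independent S" and card: "card I \<le> card S"
    and span: "S \<subseteq> span (h ` I)" and zero: "(\<Sum>i\<in>I. c i *s h i) = 0" and j: "j \<in> I"
  shows "c j = 0"
proof (rule ccontr)
  assume c: "c j \<noteq> 0"
  let ?T = "h ` (I - {j})"
  have "c j *s h j = - (\<Sum>i\<in>I - {j}. c i *s h i)"
    using zero sum.remove [OF fin j, of "\<lambda>i. c i *s h i"] by (simp add: eq_neg_iff_add_eq_0)
  moreover have "- (\<Sum>i\<in>I - {j}. c i *s h i) \<in> span ?T"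
    by (intro span_neg span_sum span_scale span_base) auto
  ultimately have "c j *s h j \<in> span ?T"
    by simp
  then have "h j \<in> span ?T"
    using c span_scale [of "c j *s h j" ?T "1 / c j"] by simp
  then have "h ` I \<subseteq> span ?T"
    by (auto intro: span_base)
  then have "S \<subseteq> span ?T"
    using span span_minimal subspace_span by blast
  then have "card S \<le> card ?T"
    using independent_span_bound fin indep by blast
  also have "\<dots> \<le> card (I - {j})"
    using fin by (intro card_image_le) auto
  also have "\<dots> < card I"
    using fin j by (intro psubset_card_mono) auto
  finally show False
    using card by simp
qed

lemma sum_fun_apply: "(\<Sum>i\<in>I. F i) j = (\<Sum>i\<in>I. F i j)"
  for F :: "_ \<Rightarrow> _ \<Rightarrow> 'b :: comm_monoid_add"
  by (induction I rule: infinite_finite_induct) auto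

text \<open>
  Affine relations become linear ones after homogenisation: the coordinates of a point are
  indexed by \<open>1, \<dots>, n\<close>, and the vacant coordinate \<open>0\<close> is set to \<open>1\<close>.  The
  homogenised \<open>e\<^sub>0, \<dots>, e\<^sub>n\<close> are \<open>n + 1\<close> independent vectors in the span of the
  \<open>n + 1\<close> homogenised points \<open>g i\<close>, so the latter are independent too.
\<close>

lemma affine_spanning_independent:
  assumes surj: "dyadic_space n \<subseteq> combination n g ` affine_weights n"
    and sum0: "(\<Sum>i=0..n. c i) = 0" and comb0: "combination n g c = (\<lambda>j. 0)"
    and j: "j \<in> {0..n}"
  shows "c j = 0"
proof -
  interpret V: vector_space "\<lambda>(c :: rat) (x :: nat \<Rightarrow> rat). (\<lambda>j. c * x j)"
    by unfold_locales (auto simp: fun_eq_iff algebra_simps)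
  define lift where "lift x = (x :: nat \<Rightarrow> rat)(0 := 1)" for x
  define S where "S = (\<lambda>i. lift (simplex_vertex i)) ` {0..n}"
  have inj: "inj_on (\<lambda>i. lift (simplex_vertex i)) {0..n}"
  proof (rule inj_onI)
    fix i k assume "lift (simplex_vertex i) = lift (simplex_vertex k)"
    then have "lift (simplex_vertex i) i = lift (simplex_vertex k) i"
      "lift (simplex_vertex i) k = lift (simplex_vertex k) k" by simp_all
    then show "i = k"
      by (auto simp: lift_def simplex_vertex_def split: if_splits)
  qed
  have "V.independent S"
  proof -
    have zero_coeff: "u i = 0" if zero: "(\<Sum>i=0..n. (\<lambda>k. u i * lift (simplex_vertex i) k)) = 0"
      and i: "i \<in> {0..n}" for u :: "nat \<Rightarrow> rat" and i
    proof -
      have eq: "(\<Sum>i=0..n. u i * lift (simplex_vertex i) k) = 0" for k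
        using fun_cong [OF zero, of k] by (simp add: sum_fun_apply)
      have pos: "u k = 0" if "k \<in> {1..n}" for k
        using eq [of k] combination_simplex_vertex [of n u k] that
        by (simp add: lift_def combination_def)
      have "(\<Sum>i=0..n. u i) = 0"
        using eq [of 0] by (simp add: lift_def)
      moreover have "(\<Sum>i=0..n. u i) = u 0"
        using pos by (simp add: sum.atLeast_Suc_atMost)
      ultimately show ?thesis
        using pos i by (cases "i = 0") auto
    qed
    have "\<forall>v\<in>S. u v = 0" if "(\<Sum>v\<in>S. (\<lambda>k. u v * v k)) = 0" for u
      using that zero_coeff [of "\<lambda>i. u (lift (simplex_vertex i))"]
      by (simp add: S_def sum.reindex [OF inj] o_def)
    moreover have "finite S"
      by (simp add: S_def)
    ultimately show ?thesis
      by (auto simp: V.dependent_finite)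
  qed
  moreover have "card {0..n} \<le> card S"
    unfolding S_def using inj by (simp add: card_image)
  moreover have "S \<subseteq> V.span ((\<lambda>i. lift (g i)) ` {0..n})"
  proof
    fix x assume "x \<in> S"
    then obtain i where i: "i \<in> {0..n}" "x = lift (simplex_vertex i)"
      by (auto simp: S_def)
    then obtain r where r: "r \<in> affine_weights n" "simplex_vertex i = combination n g r"
      using surj simplex_vertex_in_dyadic_space [of i n] by auto
    have "x = (\<Sum>i=0..n. (\<lambda>j. r i * lift (g i) j))"
      using r i by (auto simp: lift_def fun_eq_iff sum_fun_apply combination_def affine_weights_def)
    then show "x \<in> V.span ((\<lambda>i. lift (g i)) ` {0..n})"
      by (simp only:) (intro V.span_sum V.span_scale V.span_base, auto)
  qed
  moreover have "(\<Sum>i=0..n. (\<lambda>j. c i * lift (g i) j)) = 0"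
  proof
    fix k
    show "(\<Sum>i=0..n. (\<lambda>j. c i * lift (g i) j)) k = 0 k"
      using sum0 fun_cong [OF comb0, of k]
      by (cases "k = 0") (simp_all add: lift_def sum_fun_apply combination_def)
  qed
  ultimately show ?thesis
    using V.spanning_family_independent [of "{0..n}" S "\<lambda>i. lift (g i)" c j] j by simp
qed

text \<open>
  The isomorphism carries each \<open>e\<^sub>i\<close> to \<open>g i\<close> and keeps the weights.  The affine
  combinations of the \<open>g i\<close> form an affine subspace, so \<open>span\<close> makes them all of
  \<open>\<bbbD>\<^sup>n\<close>; thus the \<open>g i\<close> are independent and the map is injective.
\<close>

lemma affine_generating_convex_iso_simplex:
  assumes g: "g ` {0..n} \<subseteq> dyadic_space n"
    and span: "\<And>B. B \<subseteq> dyadic_space n \<Longrightarrow> aff_closed space_op B \<Longrightarrow> g ` {0..n} \<subseteq> B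
      \<Longrightarrow> B = dyadic_space n"
  shows "groupoid_iso (dyadic_simplex n) (mid space_op)
    (op_closed (mid space_op) hull (g ` {0..n})) (mid space_op)"
proof -
  have "g ` {0..n} \<subseteq> combination n g ` convex_weights n"
    using hull_subset midpoint_hull_eq_convex_combinations by metis
  then have "g ` {0..n} \<subseteq> combination n g ` affine_weights n"
    by (auto simp: convex_weights_def)
  then have surj: "combination n g ` affine_weights n = dyadic_space n"
    using g affine_combinations_closed
    by (intro span) (auto intro!: combination_in_dyadic_space)
  define T where "T x = combination n g (barycentric n x)" for x
  have T: "T (combination n simplex_vertex r) = combination n g r" if "r \<in> convex_weights n" for r
    unfolding T_def using that
    by (intro combination_cong barycentric_combination) (auto simp: convex_weights_def affine_weights_def)
  have "inj_on T (dyadic_simplex n)"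
  proof (rule inj_onI)
    fix x y assume "x \<in> dyadic_simplex n" "y \<in> dyadic_simplex n" "T x = T y"
    then obtain r s where r: "r \<in> convex_weights n" "x = combination n simplex_vertex r"
      and s: "s \<in> convex_weights n" "y = combination n simplex_vertex s"
      unfolding dyadic_simplex_eq by blast
    then have eq: "combination n g r = combination n g s"
      using T \<open>T x = T y\<close> by simp
    have "(\<Sum>i=0..n. r i - s i) = 0"
      using r(1) s(1) by (simp add: convex_weights_def affine_weights_def sum_subtractf)
    moreover have "combination n g (\<lambda>i. r i - s i) = (\<lambda>j. 0)"
      using eq by (auto simp: combination_def fun_eq_iff left_diff_distrib sum_subtractf)
    ultimately have "r i - s i = 0" if "i \<in> {0..n}" for i
      using affine_spanning_independent [of n g "\<lambda>i. r i - s i" i] surj that by simp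
    then show "x = y"
      unfolding r(2) s(2) by (intro combination_cong) simp
  qed
  moreover have "T ` dyadic_simplex n = op_closed (mid space_op) hull (g ` {0..n})"
    unfolding midpoint_hull_eq_convex_combinations dyadic_simplex_eq image_image
    by (rule image_cong [OF refl T])
  moreover have "T (mid space_op x y) = mid space_op (T x) (T y)" for x y
    by (simp add: T_def mid_def barycentric_space_op space_op_combination)
  ultimately show ?thesis
    unfolding groupoid_iso_def bij_betw_def by blast
qed

section \<open>Characterisations of dyadic simplices\<close>

lemma aff_closed_Inter: "(\<And>B. B \<in> \<B> \<Longrightarrow> aff_closed f B) \<Longrightarrow> aff_closed f (\<Inter>\<B>)"
  unfolding aff_closed_def by blast

text \<open>
  An isomorphism \<open>\<phi>\<close> from the affine hull of \<open>C\<close> onto \<open>\<bbbD>\<^sup>n\<close> moves the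
  question to \<open>\<phi> ` C\<close>, whose generators then lie in no proper affine subspace of
  \<open>\<bbbD>\<^sup>n\<close>: the preimage of such a subspace would be an affine subspace containing \<open>C\<close>
  and strictly smaller than its hull.
\<close>

lemma generated_by_Suc_dim_imp_iso_simplex:
  assumes conv: "algebraic_dyadic_convex_set A f C" and dim: "has_dimension A f C n"
    and gen: "generates (mid f) G C" and G: "finite G" "card G = n + 1"
  shows "groupoid_iso C (mid f) (dyadic_simplex n) (mid space_op)"
proof -
  define H where "H = aff_hull A f C"
  have A: "aff_closed f A" "C \<subseteq> A" and C: "op_closed (mid f) C"
    using conv unfolding algebraic_dyadic_convex_set_def in_QA_def by blast+
  have CH: "C \<subseteq> H"
    unfolding H_def aff_hull_def by (rule hull_subset)
  have HA: "H \<subseteq> A"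
    unfolding H_def aff_hull_def using A by (intro hull_minimal) auto
  have Hclosed: "aff_closed f H"
    unfolding H_def aff_hull_def
    by (auto simp: hull_def intro!: aff_closed_Inter)
  obtain \<phi> where bij: "bij_betw \<phi> H (dyadic_space n)"
    and hom: "\<forall>r\<in>\<bbbD>. \<forall>a\<in>H. \<forall>b\<in>H. \<phi> (f r a b) = space_op r (\<phi> a) (\<phi> b)"
    using dim unfolding has_dimension_def aff_iso_def H_def by blast
  have homC: "\<forall>a\<in>C. \<forall>b\<in>C. \<phi> (mid f a b) = mid space_op (\<phi> a) (\<phi> b)"
    unfolding mid_def using hom CH dyadic_rats_half by blast
  have genC: "generates (mid space_op) (\<phi> ` G) (\<phi> ` C)"
    by (rule generates_hom_image [OF homC C gen])
  have "groupoid_iso C (mid f) (\<phi> ` C) (mid space_op)"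
    unfolding groupoid_iso_def using homC bij_betw_subset [OF bij CH refl] by blast
  moreover
  obtain e where "bij_betw e {0..<card G} G"
    using ex_bij_betw_nat_finite G by blast
  then have eG: "e ` {0..n} = G"
    using G(2) bij_betw_imp_surj_on by (fastforce simp: atLeastLessThanSuc_atLeastAtMost)
  have g: "(\<phi> \<circ> e) ` {0..n} = \<phi> ` G"
    unfolding image_comp [symmetric] eG by (rule refl)
  have GC: "G \<subseteq> C"
    using gen by (simp add: generates_def)
  have "groupoid_iso (dyadic_simplex n) (mid space_op)
    (op_closed (mid space_op) hull ((\<phi> \<circ> e) ` {0..n})) (mid space_op)"
  proof (rule affine_generating_convex_iso_simplex)
    show "(\<phi> \<circ> e) ` {0..n} \<subseteq> dyadic_space n"
      using g GC CH bij_betw_imp_surj_on [OF bij] by blast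
    fix B assume B: "B \<subseteq> dyadic_space n" "aff_closed space_op B" "(\<phi> \<circ> e) ` {0..n} \<subseteq> B"
    have "op_closed (mid space_op) B"
      using B(2) dyadic_rats_half unfolding aff_closed_def op_closed_def mid_def by blast
    then have "op_closed (mid space_op) hull (\<phi> ` G) \<subseteq> B"
      using B(3) unfolding g by (intro hull_minimal)
    then have "\<phi> ` C \<subseteq> B"
      using genC by (simp add: generates_def)
    moreover have "aff_closed f {a \<in> H. \<phi> a \<in> B}"
      unfolding aff_closed_def
    proof (intro ballI)
      fix r a b assume "r \<in> \<bbbD>" and "a \<in> {a \<in> H. \<phi> a \<in> B}" "b \<in> {a \<in> H. \<phi> a \<in> B}"
      then have "f r a b \<in> H" "\<phi> (f r a b) \<in> B"
        using Hclosed hom B(2) by (auto simp: aff_closed_def)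
      then show "f r a b \<in> {a \<in> H. \<phi> a \<in> B}"
        by simp
    qed
    moreover have "C \<subseteq> {a \<in> H. \<phi> a \<in> B}" "{a \<in> H. \<phi> a \<in> B} \<subseteq> A"
      using \<open>\<phi> ` C \<subseteq> B\<close> CH HA by blast+
    ultimately have "aff_hull A f C \<subseteq> {a \<in> H. \<phi> a \<in> B}"
      unfolding aff_hull_def by (intro hull_minimal conjI)
    then have "H \<subseteq> {a \<in> H. \<phi> a \<in> B}"
      by (simp only: H_def)
    then have "\<phi> ` H \<subseteq> B"
      by blast
    then show "B = dyadic_space n"
      using B(1) bij_betw_imp_surj_on [OF bij] by simp
  qed
  then have "groupoid_iso (dyadic_simplex n) (mid space_op) (\<phi> ` C) (mid space_op)"
    using g genC by (simp add: generates_def)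
  then have "groupoid_iso (\<phi> ` C) (mid space_op) (dyadic_simplex n) (mid space_op)"
    by (rule groupoid_iso_sym [OF _ dyadic_simplex_closed])
  ultimately show ?thesis
    by (rule groupoid_iso_trans)
qed

lemma iso_simplex_imp_generated_by_vertices:
  assumes closed: "op_closed m C"
    and iso: "groupoid_iso C m (dyadic_simplex n) (mid space_op)"
  shows "card (vertices m C) = n + 1" "generates m (vertices m C) C"
proof -
  obtain \<phi> where bij: "bij_betw \<phi> (dyadic_simplex n) C"
    and hom: "\<forall>a\<in>dyadic_simplex n. \<forall>b\<in>dyadic_simplex n. \<phi> (mid space_op a b) = m (\<phi> a) (\<phi> b)"
    using groupoid_iso_sym [OF iso closed] by (auto simp: groupoid_iso_def)
  have C: "\<phi> ` dyadic_simplex n = C" and inj: "inj_on \<phi> (dyadic_simplex n)"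
    using bij by (auto simp: bij_betw_def)
  have V: "vertices m C = \<phi> ` vertices (mid space_op) (dyadic_simplex n)"
    using vertices_iso_image [OF hom dyadic_simplex_closed inj] C by simp
  have "inj_on \<phi> (vertices (mid space_op) (dyadic_simplex n))"
    by (rule inj_on_subset [OF inj]) (auto simp: vertices_def)
  then show "card (vertices m C) = n + 1"
    by (simp add: V card_image card_vertices_dyadic_simplex)
  show "generates m (vertices m C) C"
    using generates_hom_image [OF hom dyadic_simplex_closed dyadic_simplex_generated]
    by (simp add: V C vertices_dyadic_simplex)
qed

theorem lemma2p12:
  fixes n :: nat
    and A C :: "'a set"
    and f :: "rat \<Rightarrow> 'a \<Rightarrow> 'a \<Rightarrow> 'a"
  assumes "n > 0"
    and "algebraic_dyadic_convex_set A f C"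
    and "has_dimension A f C n"
  shows "(groupoid_iso C (mid f) (dyadic_simplex n) (mid space_op)
            \<longleftrightarrow> k_generated (mid f) C (n + 1))
       \<and> (k_generated (mid f) C (n + 1)
            \<longleftrightarrow> card (vertices (mid f) C) = n + 1 \<and> generates (mid f) (vertices (mid f) C) C)"
proof -
  have closed: "op_closed (mid f) C"
    using assms(2) unfolding algebraic_dyadic_convex_set_def by blast
  have "groupoid_iso C (mid f) (dyadic_simplex n) (mid space_op)"
    if "k_generated (mid f) C (n + 1)"
    using generated_by_Suc_dim_imp_iso_simplex [OF assms(2,3)] that by (auto simp: k_generated_def)
  moreover have "card (vertices (mid f) C) = n + 1 \<and> generates (mid f) (vertices (mid f) C) C"
    if "groupoid_iso C (mid f) (dyadic_simplex n) (mid space_op)"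
    using iso_simplex_imp_generated_by_vertices [OF closed that] by simp
  moreover have "k_generated (mid f) C (n + 1)"
    if "card (vertices (mid f) C) = n + 1" "generates (mid f) (vertices (mid f) C) C"
    using k_generated_by_vertices [OF closed that(2)] that(1) card_ge_0_finite [of "vertices (mid f) C"]
    by simp
  ultimately show ?thesis
    by blast
qed

end
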